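(* (Soundness) Every formula derivable in $\mathsf{Syn}^-$ is true at every world of every $\kappa$-model.
   Context: Fix a finite set $\mathsf{Ag}$ of agents; an agent pattern is a set $G\subseteq\mathcal{P}(\mathsf{Ag})\setminus\{\emptyset\}$. Formulas: $\varphi::= p\mid\neg\varphi\mid\varphi\wedge\varphi\mid [G]\varphi$ ($p$ in a countable set $\mathsf{Prop}$, $G$ an agent pattern); $\bot:=p\wedge\neg p$ for fixed $p$; $\mathsf{alive}(G):=\neg[G]\bot$. $\mathsf{Syn}^-$ has axioms: all propositional tautologies; (K) $[G](\varphi\to\psi)\to([G]\varphi\to[G]\psi)$; (B) $\varphi\to[G]\neg[G]\neg\varphi$; (4) $[G]\varphi\to[G][G]\varphi$; (T) $\mathsf{alive}(G)\to([G]\varphi\to\varphi)$; (NE) $\bigvee_{G}\mathsf{alive}(G)$ over all agent patterns; (Mono) $[G]\varphi\to[H]\varphi$ if $G\subseteq H$; (Equiv) $[G\cup\{B\}]\varphi\to[G]\varphi$ if some $A\in G$ has $B\subseteq A$ ($B\ne\emptyset$); (Union) $\mathsf{alive}(G)\wedge\mathsf{alive}(H)\to\mathsf{alive}(G\cup H)$; (Clo) $\mathsf{alive}(G)\to\mathsf{alive}(\{A\cup B\})$ for $A,B\in G$; rules modus ponens and $[G]$-necessitation (from $\varphi$ infer $[G]\varphi$). A pre-model $\mathcal{M}=(W,\sim,V)$ consists of a set $W$, a function assigning to each agent pattern $G$ a symmetric and transitive relation $\sim_G$ on $W$, and $V:W\to\mathcal{P}(\mathsf{Prop})$. Truth: $\mathcal{M},w\Vdash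 p$ iff $p\in V(w)$; Boolean clauses as usual; $\mathcal{M},w\Vdash[G]\varphi$ iff $\mathcal{M},v\Vdash\varphi$ for all $v$ with $w\sim_G v$. Let $\mathsf{alive}(G)_\mathcal{M}=\{w\mid w\sim_G w\}$. A $\kappa$-model is a pre-model such that for all agent patterns $G,H$: (K1) $\mathsf{alive}(G)_\mathcal{M}\cap\mathsf{alive}(H)_\mathcal{M}\subseteq\mathsf{alive}(G\cup H)_\mathcal{M}$; (K2) $\mathsf{alive}(G)_\mathcal{M}\subseteq\mathsf{alive}(\{A\cup B\})_\mathcal{M}$ for $A,B\in G$; (K3) $\sim_H\subseteq\sim_G$ if $G\subseteq H$; (K4) $\sim_G\subseteq\sim_{G\cup\{B\}}$ if some $A\in G$ has $\emptyset\ne B\subseteq A$; (NE) for every $w\in W$ there is an agent pattern $G$ with $w\sim_G w$. *)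

theory Defs
  imports Main "HOL-Library.Countable"
begin

definition agent_patterns :: "'a set \<Rightarrow> 'a set set set" where
  "agent_patterns Ag = Pow (Pow Ag - {{}})"

(* Raw syntax; the formulas over Ag are singled out by the inductive set below,
   which restricts the modalities to agent patterns over Ag. *)
datatype ('a, 'p) fm =
    Atom 'p
  | Neg "('a, 'p) fm"
  | Conj "('a, 'p) fm" "('a, 'p) fm"
  | Box "'a set set" "('a, 'p) fm"

inductive_set formulas :: "'a set \<Rightarrow> ('a, 'p) fm set" for Ag :: "'a set" where
  "Atom p \<in> formulas Ag"
| "\<phi> \<in> formulas Ag \<Longrightarrow> Neg \<phi> \<in> formulas Ag"
| "\<phi> \<in> formulas Ag \<Longrightarrow> \<psi> \<in> formulas Ag \<Longrightarrow> Conj \<phi> \<psi> \<in> formulas Ag"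
| "G \<in> agent_patterns Ag \<Longrightarrow> \<phi> \<in> formulas Ag \<Longrightarrow> Box G \<phi> \<in> formulas Ag"

definition Imp :: "('a, 'p) fm \<Rightarrow> ('a, 'p) fm \<Rightarrow> ('a, 'p) fm" where
  "Imp \<phi> \<psi> = Neg (Conj \<phi> (Neg \<psi>))"

definition Disj :: "('a, 'p) fm \<Rightarrow> ('a, 'p) fm \<Rightarrow> ('a, 'p) fm" where
  "Disj \<phi> \<psi> = Neg (Conj (Neg \<phi>) (Neg \<psi>))"

(* The parameter p0 is, here and below, the fixed proposition used to express falsity. *)
definition Bot :: "'p \<Rightarrow> ('a, 'p) fm" where
  "Bot p0 = Conj (Atom p0) (Neg (Atom p0))"

definition Alive :: "'p \<Rightarrow> 'a set set \<Rightarrow> ('a, 'p) fm" where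
  "Alive p0 G = Neg (Box G (Bot p0))"

fun Disjs :: "'p \<Rightarrow> ('a, 'p) fm list \<Rightarrow> ('a, 'p) fm" where
  "Disjs p0 [] = Bot p0"
| "Disjs p0 [\<phi>] = \<phi>"
| "Disjs p0 (\<phi> # \<psi> # \<chi>s) = Disj \<phi> (Disjs p0 (\<psi> # \<chi>s))"

(* Boxed formulas are treated as propositional atoms. *)
primrec prop_eval :: "(('a, 'p) fm \<Rightarrow> bool) \<Rightarrow> ('a, 'p) fm \<Rightarrow> bool" where
  "prop_eval \<nu> (Atom p) \<longleftrightarrow> \<nu> (Atom p)"
| "prop_eval \<nu> (Neg \<phi>) \<longleftrightarrow> \<not> prop_eval \<nu> \<phi>"
| "prop_eval \<nu> (Conj \<phi> \<psi>) \<longleftrightarrow> prop_eval \<nu> \<phi> \<and> prop_eval \<nu> \<psi>"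
| "prop_eval \<nu> (Box G \<phi>) \<longleftrightarrow> \<nu> (Box G \<phi>)"

definition tautology :: "('a, 'p) fm \<Rightarrow> bool" where
  "tautology \<phi> \<longleftrightarrow> (\<forall>\<nu>. prop_eval \<nu> \<phi>)"

(* In NE the order of the disjuncts is immaterial, so every repetition-free
   enumeration of the (finitely many) agent patterns is admitted. *)
inductive Syn_minus :: "'a set \<Rightarrow> 'p \<Rightarrow> ('a, 'p) fm \<Rightarrow> bool"
  for Ag :: "'a set" and p0 :: 'p
where
  Taut: "\<phi> \<in> formulas Ag \<Longrightarrow> tautology \<phi> \<Longrightarrow> Syn_minus Ag p0 \<phi>"
| K: "G \<in> agent_patterns Ag \<Longrightarrow> \<phi> \<in> formulas Ag \<Longrightarrow> \<psi> \<in> formulas Ag \<Longrightarrow>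
    Syn_minus Ag p0 (Imp (Box G (Imp \<phi> \<psi>)) (Imp (Box G \<phi>) (Box G \<psi>)))"
| B: "G \<in> agent_patterns Ag \<Longrightarrow> \<phi> \<in> formulas Ag \<Longrightarrow>
    Syn_minus Ag p0 (Imp \<phi> (Box G (Neg (Box G (Neg \<phi>)))))"
| Four: "G \<in> agent_patterns Ag \<Longrightarrow> \<phi> \<in> formulas Ag \<Longrightarrow>
    Syn_minus Ag p0 (Imp (Box G \<phi>) (Box G (Box G \<phi>)))"
| T: "G \<in> agent_patterns Ag \<Longrightarrow> \<phi> \<in> formulas Ag \<Longrightarrow>
    Syn_minus Ag p0 (Imp (Alive p0 G) (Imp (Box G \<phi>) \<phi>))"
| NE: "set Gs = agent_patterns Ag \<Longrightarrow> distinct Gs \<Longrightarrow>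
    Syn_minus Ag p0 (Disjs p0 (map (Alive p0) Gs))"
| Mono: "G \<in> agent_patterns Ag \<Longrightarrow> H \<in> agent_patterns Ag \<Longrightarrow> \<phi> \<in> formulas Ag \<Longrightarrow>
    G \<subseteq> H \<Longrightarrow> Syn_minus Ag p0 (Imp (Box G \<phi>) (Box H \<phi>))"
| Equiv: "G \<in> agent_patterns Ag \<Longrightarrow> \<phi> \<in> formulas Ag \<Longrightarrow>
    A \<in> G \<Longrightarrow> B \<subseteq> A \<Longrightarrow> B \<noteq> {} \<Longrightarrow>
    Syn_minus Ag p0 (Imp (Box (G \<union> {B}) \<phi>) (Box G \<phi>))"
| Union: "G \<in> agent_patterns Ag \<Longrightarrow> H \<in> agent_patterns Ag \<Longrightarrow>
    Syn_minus Ag p0 (Imp (Conj (Alive p0 G) (Alive p0 H)) (Alive p0 (G \<union> H)))"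
| Clo: "G \<in> agent_patterns Ag \<Longrightarrow> A \<in> G \<Longrightarrow> B \<in> G \<Longrightarrow>
    Syn_minus Ag p0 (Imp (Alive p0 G) (Alive p0 {A \<union> B}))"
| MP: "Syn_minus Ag p0 \<phi> \<Longrightarrow> Syn_minus Ag p0 (Imp \<phi> \<psi>) \<Longrightarrow> Syn_minus Ag p0 \<psi>"
| Nec: "G \<in> agent_patterns Ag \<Longrightarrow> Syn_minus Ag p0 \<phi> \<Longrightarrow> Syn_minus Ag p0 (Box G \<phi>)"

record ('w, 'a, 'p) model =
  worlds :: "'w set"
  rel :: "'a set set \<Rightarrow> ('w \<times> 'w) set"
  val :: "'w \<Rightarrow> 'p set"

definition pre_model :: "'a set \<Rightarrow> ('w, 'a, 'p) model \<Rightarrow> bool" where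
  "pre_model Ag M \<longleftrightarrow>
    (\<forall>G \<in> agent_patterns Ag.
      rel M G \<subseteq> worlds M \<times> worlds M \<and> sym (rel M G) \<and> trans (rel M G))"

fun sat :: "('w, 'a, 'p) model \<Rightarrow> 'w \<Rightarrow> ('a, 'p) fm \<Rightarrow> bool" where
  "sat M w (Atom p) \<longleftrightarrow> p \<in> val M w"
| "sat M w (Neg \<phi>) \<longleftrightarrow> \<not> sat M w \<phi>"
| "sat M w (Conj \<phi> \<psi>) \<longleftrightarrow> sat M w \<phi> \<and> sat M w \<psi>"
| "sat M w (Box G \<phi>) \<longleftrightarrow> (\<forall>v. (w, v) \<in> rel M G \<longrightarrow> sat M v \<phi>)"

definition alive_set :: "('w, 'a, 'p) model \<Rightarrow> 'a set set \<Rightarrow> 'w set" where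
  "alive_set M G = {w \<in> worlds M. (w, w) \<in> rel M G}"

definition kappa_model :: "'a set \<Rightarrow> ('w, 'a, 'p) model \<Rightarrow> bool" where
  "kappa_model Ag M \<longleftrightarrow>
    pre_model Ag M \<and>
    (\<forall>G \<in> agent_patterns Ag. \<forall>H \<in> agent_patterns Ag.
      alive_set M G \<inter> alive_set M H \<subseteq> alive_set M (G \<union> H)) \<and>
    (\<forall>G \<in> agent_patterns Ag. \<forall>A \<in> G. \<forall>B \<in> G. alive_set M G \<subseteq> alive_set M {A \<union> B}) \<and>
    (\<forall>G \<in> agent_patterns Ag. \<forall>H \<in> agent_patterns Ag. G \<subseteq> H \<longrightarrow> rel M H \<subseteq> rel M G) \<and>
    (\<forall>G \<in> agent_patterns Ag. \<forall>B. (\<exists>A \<in> G. B \<noteq> {} \<and> B \<subseteq> A) \<longrightarrow>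
      rel M G \<subseteq> rel M (G \<union> {B})) \<and>
    (\<forall>w \<in> worlds M. \<exists>G \<in> agent_patterns Ag. (w, w) \<in> rel M G)"

end

theory Submission imports Defs begin

text \<open>Since each accessibility relation is symmetric and transitive, a world with any successor
  under a pattern is related to itself. Hence \<open>Alive p0 G\<close> holds exactly at the reflexive points
  of \<open>rel M G\<close>, and every axiom of \<open>Syn_minus\<close> becomes one of the frame conditions.\<close>

lemma sat_Imp [simp]: "sat M w (Imp \<phi> \<psi>) \<longleftrightarrow> (sat M w \<phi> \<longrightarrow> sat M w \<psi>)"
  by (simp add: Imp_def)

lemma sat_Disj [simp]: "sat M w (Disj \<phi> \<psi>) \<longleftrightarrow> sat M w \<phi> \<or> sat M w \<psi>"
  by (auto simp: Disj_def)

lemma sat_Bot [simp]: "\<not> sat M w (Bot p0)"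
  by (simp add: Bot_def)

lemma sat_Disjs [simp]: "sat M w (Disjs p0 \<phi>s) \<longleftrightarrow> (\<exists>\<phi>\<in>set \<phi>s. sat M w \<phi>)"
  by (induction p0 \<phi>s rule: Disjs.induct) auto

text \<open>Truth at a fixed world is itself a valuation of atoms and boxed formulas, so a
  tautology, being true under all valuations, is true at that world.\<close>

lemma prop_eval_sat: "prop_eval (sat M w) \<phi> \<longleftrightarrow> sat M w \<phi>"
  by (induction \<phi>) auto

lemma tautology_sat: "tautology \<phi> \<Longrightarrow> sat M w \<phi>"
  unfolding tautology_def by (simp flip: prop_eval_sat)

lemma pre_modelD:
  assumes "pre_model Ag M" "G \<in> agent_patterns Ag"
  shows "rel M G \<subseteq> worlds M \<times> worlds M" "sym (rel M G)" "trans (rel M G)"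
  using assms by (auto simp: pre_model_def)

lemma sat_Alive_iff:
  assumes "pre_model Ag M" "G \<in> agent_patterns Ag"
  shows "sat M w (Alive p0 G) \<longleftrightarrow> w \<in> alive_set M G"
proof -
  have "(w, w) \<in> rel M G" if "(w, v) \<in> rel M G" for v
    using that pre_modelD(2,3)[OF assms] by (meson symD transD)
  then show ?thesis
    \<comment> \<open>The relation lives on \<open>worlds M\<close>, so a loop at \<open>w\<close>
      already puts \<open>w\<close> into \<open>worlds M\<close>, as \<open>alive_set\<close>
      demands.\<close>
    using pre_modelD(1)[OF assms] by (auto simp: Alive_def alive_set_def)
qed

text \<open>\<open>sat_Alive_iff\<close> speaks of agent patterns only; this closure and the next
  one make it applicable to the conclusions of \<open>Union\<close> and \<open>Clo\<close>.\<close>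

lemma agent_patterns_Un:
  "G \<in> agent_patterns Ag \<Longrightarrow> H \<in> agent_patterns Ag \<Longrightarrow> G \<union> H \<in> agent_patterns Ag"
  by (auto simp: agent_patterns_def)

lemma agent_patterns_join:
  "G \<in> agent_patterns Ag \<Longrightarrow> A \<in> G \<Longrightarrow> B \<in> G \<Longrightarrow> {A \<union> B} \<in> agent_patterns Ag"
  by (auto simp: agent_patterns_def)

lemma kappa_model_pre_model: "kappa_model Ag M \<Longrightarrow> pre_model Ag M"
  by (simp add: kappa_model_def)

lemma kappa_model_alive_Un:
  assumes "kappa_model Ag M" "G \<in> agent_patterns Ag" "H \<in> agent_patterns Ag"
  shows "alive_set M G \<inter> alive_set M H \<subseteq> alive_set M (G \<union> H)"
  using assms by (simp add: kappa_model_def)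

lemma kappa_model_alive_join:
  assumes "kappa_model Ag M" "G \<in> agent_patterns Ag" "A \<in> G" "B \<in> G"
  shows "alive_set M G \<subseteq> alive_set M {A \<union> B}"
  using assms by (simp add: kappa_model_def)

lemma kappa_model_rel_antimono:
  assumes "kappa_model Ag M" "G \<in> agent_patterns Ag" "H \<in> agent_patterns Ag" "G \<subseteq> H"
  shows "rel M H \<subseteq> rel M G"
  using assms by (simp add: kappa_model_def)

lemma kappa_model_rel_insert:
  assumes "kappa_model Ag M" "G \<in> agent_patterns Ag" "A \<in> G" "B \<subseteq> A" "B \<noteq> {}"
  shows "rel M G \<subseteq> rel M (G \<union> {B})"
proof -
  have "\<forall>G \<in> agent_patterns Ag. \<forall>B. (\<exists>A \<in> G. B \<noteq> {} \<and> B \<subseteq> A) \<longrightarrow> rel M G \<subseteq> rel M (G \<union> {B})"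
    using assms(1) unfolding kappa_model_def by (elim conjE)
  then show ?thesis
    using assms(2-) by blast
qed

lemma kappa_model_NE:
  assumes "kappa_model Ag M" "w \<in> worlds M"
  shows "\<exists>G\<in>agent_patterns Ag. w \<in> alive_set M G"
  using assms by (simp add: kappa_model_def alive_set_def)

theorem theorem5p10:
  fixes Ag :: "'a set" and p0 :: "'p::countable" and \<phi> :: "('a, 'p) fm"
    and M :: "('w, 'a, 'p) model" and w :: 'w
  assumes "finite Ag"
    and "Syn_minus Ag p0 \<phi>"
    and "kappa_model Ag M"
    and "w \<in> worlds M"
  shows "sat M w \<phi>"
proof -
  note k = assms(3)
  note pre = kappa_model_pre_model[OF k]
  note alive = sat_Alive_iff[OF pre]
  show ?thesis
    using assms(2,4)
  \<comment> \<open>The world is generalised because necessitation uses the induction hypothesis at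
    the successors of \<open>w\<close>.\<close>
  proof (induction arbitrary: w rule: Syn_minus.induct)
    case (Taut \<phi>)
    then show ?case by (simp add: tautology_sat)
  next
    case (K G \<phi> \<psi>)
    then show ?case by simp
  next
    case (B G \<phi>)
    \<comment> \<open>By symmetry \<open>w\<close> is a successor of each of its successors, and
      there it witnesses the diamond.\<close>
    then show ?case using pre_modelD(2)[OF pre, of G] by (auto dest: symD)
  next
    case (Four G \<phi>)
    then show ?case using pre_modelD(3)[OF pre, of G] by (auto dest: transD)
  next
    case (T G \<phi>)
    then show ?case by (auto simp: alive alive_set_def)
  next
    case (NE Gs)
    then show ?case using kappa_model_NE[OF k] by (auto simp: alive)
  next
    case (Mono G H \<phi>)
    \<comment> \<open>The larger pattern has the smaller relation, hence fewer successors to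
      check.\<close>
    then show ?case using kappa_model_rel_antimono[OF k, of G H] by auto
  next
    case (Equiv G \<phi> A B)
    then show ?case using kappa_model_rel_insert[OF k, of G A B] by auto
  next
    case (Union G H)
    then show ?case using kappa_model_alive_Un[OF k, of G H] by (auto simp: alive agent_patterns_Un)
  next
    case (Clo G A B)
    then show ?case using kappa_model_alive_join[OF k, of G A B] by (auto simp: alive agent_patterns_join)
  next
    case (MP \<phi> \<psi>)
    then show ?case by simp
  next
    case (Nec G \<phi>)
    \<comment> \<open>Successors stay inside \<open>worlds M\<close>, where the induction hypothesis
      holds.\<close>
    then show ?case using pre_modelD(1)[OF pre, of G] by auto
  qed
qed

end
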